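(* Let $B:\mathbb{R}\to\mathbb{R}$ be an admissible function (as defined in the context) which is also convex. Let $u:\mathbb{R}\to\mathbb{R}$ be smooth with $u''(x)\ge\lambda$ for all $x\in\mathbb{R}$, for some constant $\lambda>0$. Then there exists a constant $\kappa>0$, independent of $h$, such that for every step size $h>0$ and every $f^h\in\mathcal{H}^1(\pi^h)$, $$\left\langle (f^h)^2,\pi^h\right\rangle-\left\langle f^h,\pi^h\right\rangle^2\le\frac1\kappa\left\langle\Gamma^h(f^h,f^h),\pi^h\right\rangle .$$
   Context: A function $B:\mathbb{R}\to\mathbb{R}$ is called admissible if $B\in C^1(\mathbb{R})$, $B$ is Lipschitz continuous, $B(0)=1$, $B(s)>0$ for all $s$, $\ln B(-s)-\ln B(s)=s$ for all $s$, and $B$ is monotonically decreasing. Given a potential $u$ and a step size $h>0$, set $x_i=ih$, $u_i=u(x_i)$ for $i\in\mathbb{Z}$, and $$\alpha_i=\frac{1}{h^2}B(u_{i+1}-u_i),\qquad \beta_i=\frac1{h^2}B(u_{i-1}-u_i),\qquad \pi_i=\frac{e^{-u_i}}{\sum_{j\in\mathbb{Z}}e^{-u_j}},\qquad \pi^h=\{\pi_i\}_{i\in\mathbb{Z}}.$$ For sequences $f^h=\{f_i\}_{i\in\mathbb{Z}}$, $g^h=\{g_i\}_{i\in\mathbb{Z}}$ of real numbers: $\langle f^h,g^h\rangle=\sum_{i\in\mathbb{Z}}f_ig_i$; products and squares are componentwise; $\Delta^+f_i=f_{i+1}-f_i$, $\Delta^-f_i=f_i-f_{i-1}$; $$\left(\Gamma^h(f^h,g^h)\right)_i=\tfrac12\alpha_i\Delta^+f_i\Delta^+g_i+\tfrac12\beta_i\Delta^-f_i\Delta^-g_i.$$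 $\mathcal{H}^1(\pi^h)$ is the set of real sequences $f^h$ with $\langle (f^h)^2,\pi^h\rangle+\langle\Gamma^h(f^h,f^h),\pi^h\rangle<+\infty$. *)

theory Defs
  imports "HOL-Analysis.Analysis"
begin

definition admissible :: "(real \<Rightarrow> real) \<Rightarrow> bool" where
  "admissible B \<longleftrightarrow>
     B C1_differentiable_on UNIV \<and>
     (\<exists>L. L-lipschitz_on UNIV B) \<and>
     B 0 = 1 \<and>
     (\<forall>s. B s > 0) \<and>
     (\<forall>s. ln (B (- s)) - ln (B s) = s) \<and>
     antimono B"

text \<open>Smooth means infinitely differentiable on the whole line: every iterated derivative exists
  everywhere, so that \<^term>\<open>deriv\<close> always denotes an actual derivative.\<close>

definition smooth :: "(real \<Rightarrow> real) \<Rightarrow> bool" where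
  "smooth u \<longleftrightarrow> (\<forall>n x. (deriv ^^ n) u field_differentiable (at x))"

text \<open>Grid values \<open>u\<^sub>i = u(i h)\<close>; real sequences indexed by the integers are functions
  \<^typ>\<open>int \<Rightarrow> real\<close>.\<close>

definition grid :: "(real \<Rightarrow> real) \<Rightarrow> real \<Rightarrow> int \<Rightarrow> real" where
  "grid u h i = u (of_int i * h)"

definition alpha :: "(real \<Rightarrow> real) \<Rightarrow> (real \<Rightarrow> real) \<Rightarrow> real \<Rightarrow> int \<Rightarrow> real" where
  "alpha B u h i = 1 / h\<^sup>2 * B (grid u h (i + 1) - grid u h i)"

definition beta :: "(real \<Rightarrow> real) \<Rightarrow> (real \<Rightarrow> real) \<Rightarrow> real \<Rightarrow> int \<Rightarrow> real" where
  "beta B u h i = 1 / h\<^sup>2 * B (grid u h (i - 1) - grid u h i)"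

definition pi_h :: "(real \<Rightarrow> real) \<Rightarrow> real \<Rightarrow> int \<Rightarrow> real" where
  "pi_h u h i = exp (- grid u h i) / (\<Sum>\<^sub>\<infinity>j. exp (- grid u h j))"

definition seq_inner :: "(int \<Rightarrow> real) \<Rightarrow> (int \<Rightarrow> real) \<Rightarrow> real" where
  "seq_inner f g = (\<Sum>\<^sub>\<infinity>i. f i * g i)"

definition Delta_plus :: "(int \<Rightarrow> real) \<Rightarrow> int \<Rightarrow> real" where
  "Delta_plus f i = f (i + 1) - f i"

definition Delta_minus :: "(int \<Rightarrow> real) \<Rightarrow> int \<Rightarrow> real" where
  "Delta_minus f i = f i - f (i - 1)"

definition Gamma_h ::
  "(real \<Rightarrow> real) \<Rightarrow> (real \<Rightarrow> real) \<Rightarrow> real \<Rightarrow> (int \<Rightarrow> real) \<Rightarrow> (int \<Rightarrow> real) \<Rightarrow> int \<Rightarrow> real" where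
  "Gamma_h B u h f g i =
     1 / 2 * alpha B u h i * Delta_plus f i * Delta_plus g i +
     1 / 2 * beta B u h i * Delta_minus f i * Delta_minus g i"

text \<open>For positive \<open>B\<close> both series have nonnegative terms, so finiteness of the sum of their values
  is summability of each. It has to be stated as summability: \<^const>\<open>infsum\<close> is a real number,
  with value \<open>0\<close> when the series diverges.\<close>

definition H1 :: "(real \<Rightarrow> real) \<Rightarrow> (real \<Rightarrow> real) \<Rightarrow> real \<Rightarrow> (int \<Rightarrow> real) set" where
  "H1 B u h = {f. (\<lambda>i. (f i)\<^sup>2 * pi_h u h i) summable_on UNIV \<and>
                  (\<lambda>i. Gamma_h B u h f f i * pi_h u h i) summable_on UNIV}"

end

(* The variance is the sum of pi_i pi_j (f_j - f_i)^2 over i < j. By Cauchy-Schwarz,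
   (f_j - f_i)^2 is at most j - i times the sum of (f_{k+1} - f_k)^2 over i <= k < j. If the
   increments of b = beta - alpha are at least c > 0, then j - i <= (b_j - b_i) / c. By detailed
   balance b_i pi_i = a_{i-1} - a_i with a_i = alpha_i pi_i, so the coefficient of
   (f_{k+1} - f_k)^2 telescopes to at most a_k / c, which is the Poincare inequality with kappa = c.

   The increment of b at i combines decrements of the convex decreasing function B over
   intervals of length at least d = lam h^2, one starting at s and one at -s, where
   s = u_{i+1} - u_i. It is thus at least (B(-t) - B(d - t)) / h^2 whenever |s| >= t. For h <= H
   take t = 0. That bound vanishes as h grows, but for large h all slopes satisfy |s| >= d / 4,
   and with t = d / 4 the tangent bound B(-t) >= 1 + t / 2 gives the bound lam / 8. *)

theory Submission
  imports Defs
begin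

section \<open>Poincare inequality on a finite window of integers\<close>

lemma sum_telescope_int:
  fixes f :: "int \<Rightarrow> 'a::ab_group_add"
  assumes "m \<le> n"
  shows "(\<Sum>k\<in>{m..<n}. f (k + 1) - f k) = f n - f m"
  using assms
proof (induction n rule: int_ge_induct)
  case (step n)
  then have "{m..<n+1} = insert n {m..<n}" by auto
  then show ?case using step by simp
qed simp

lemma square_diff_le_sum_squares:
  fixes f :: "int \<Rightarrow> real"
  assumes "i < j"
  shows "(f j - f i)\<^sup>2 \<le> of_int (j - i) * (\<Sum>k\<in>{i..<j}. (f (k + 1) - f k)\<^sup>2)"
  using sum_squared_le_sum_of_squares[of "\<lambda>k. f (k + 1) - f k" "{i..<j}"]
    sum_telescope_int[of i j f] assms
  by (simp add: mult.commute)

lemma increment_int_ge: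
  fixes b :: "int \<Rightarrow> real"
  assumes "\<And>i. b (i + 1) - b i \<ge> c" and "i \<le> j"
  shows "b j - b i \<ge> c * of_int (j - i)"
  using assms(2)
proof (induction j rule: int_ge_induct)
  case (step j)
  then show ?case using assms(1)[of j] by (simp add: algebra_simps)
qed simp

text \<open>Lagrange's identity: expanding the square separates the variables. For weights of mass 1
  the right side is twice the variance; the mass is kept as a factor since a finite window need not
  have mass 1.\<close>

lemma sum_pairs_square_diff:
  fixes p f :: "'i \<Rightarrow> real"
  shows "(\<Sum>i\<in>A. \<Sum>j\<in>A. p i * p j * (f j - f i)\<^sup>2)
           = 2 * ((\<Sum>i\<in>A. p i) * (\<Sum>i\<in>A. p i * (f i)\<^sup>2) - (\<Sum>i\<in>A. p i * f i)\<^sup>2)"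
proof -
  have "(\<Sum>i\<in>A. \<Sum>j\<in>A. p i * p j * (f j - f i)\<^sup>2)
      = (\<Sum>i\<in>A. \<Sum>j\<in>A. p i * (p j * (f j)\<^sup>2) + (p i * (f i)\<^sup>2) * p j - 2 * ((p i * f i) * (p j * f j)))"
    by (intro sum.cong refl) (simp add: power2_eq_square algebra_simps)
  also have "\<dots> = (\<Sum>i\<in>A. p i) * (\<Sum>i\<in>A. p i * (f i)\<^sup>2) + (\<Sum>i\<in>A. p i * (f i)\<^sup>2) * (\<Sum>i\<in>A. p i)
      - 2 * ((\<Sum>i\<in>A. p i * f i) * (\<Sum>i\<in>A. p i * f i))"
    by (simp add: sum.distrib sum_subtractf sum_distrib_left[symmetric] sum_product)
  finally show ?thesis by (simp add: power2_eq_square)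
qed

lemma sum_symmetric_pairs:
  fixes g :: "'i::linorder \<Rightarrow> 'i \<Rightarrow> real"
  assumes "\<And>i j. g i j = g j i" and "\<And>i. g i i = 0"
  shows "(\<Sum>i\<in>A. \<Sum>j\<in>A. g i j) = 2 * (\<Sum>i\<in>A. \<Sum>j\<in>A. if i < j then g i j else 0)"
proof -
  have "(\<Sum>i\<in>A. \<Sum>j\<in>A. g i j)
      = (\<Sum>i\<in>A. \<Sum>j\<in>A. (if i < j then g i j else 0) + (if j < i then g j i else 0))"
    by (intro sum.cong refl) (use assms in \<open>auto simp: not_less order.order_iff_strict\<close>)
  also have "\<dots> = (\<Sum>i\<in>A. \<Sum>j\<in>A. if i < j then g i j else 0)
      + (\<Sum>i\<in>A. \<Sum>j\<in>A. if j < i then g j i else 0)"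
    by (simp add: sum.distrib)
  also have "(\<Sum>i\<in>A. \<Sum>j\<in>A. if j < i then g j i else 0)
      = (\<Sum>i\<in>A. \<Sum>j\<in>A. if i < j then g i j else 0)"
    by (rule sum.swap)
  finally show ?thesis by simp
qed

text \<open>The left side collects all pairs that straddle the edge from \<open>k\<close> to
  \<open>k + 1\<close>. As \<open>b i * p i\<close> telescopes, it equals
  \<open>P * (a k - a n) - (a (m - 1) - a k) * Q\<close>, where \<open>P\<close> and
  \<open>Q\<close> are the masses on the two sides of the edge. The boundary terms
  \<open>a n\<close> and \<open>a (m - 1)\<close> enter with a favourable sign and are
  dropped.\<close>

lemma edge_weight_le:
  fixes p a b :: "int \<Rightarrow> real"
  assumes a: "\<And>i. a i \<ge> 0" and p: "\<And>i. p i \<ge> 0"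
    and bp: "\<And>i. b i * p i = a (i - 1) - a i"
    and k: "m \<le> k" "k < n"
  shows "(\<Sum>i\<in>{m..k}. \<Sum>j\<in>{k+1..n}. p i * p j * (b j - b i)) \<le> a k * (\<Sum>i\<in>{m..n}. p i)"
proof -
  have tel: "(\<Sum>i\<in>{l..r}. b i * p i) = a (l - 1) - a r" if "l \<le> r" for l r
  proof -
    have "{l..r} = {l..<r+1}" by auto
    then have "(\<Sum>i\<in>{l..r}. b i * p i) = (\<Sum>i\<in>{l..<r+1}. (- a (i + 1 - 1)) - (- a (i - 1)))"
      by (simp add: bp)
    also have "\<dots> = a (l - 1) - a r"
      using sum_telescope_int[of l "r+1" "\<lambda>i. - a (i - 1)"] that by simp
    finally show ?thesis .
  qed
  define P Q where "P = (\<Sum>i\<in>{m..k}. p i)" and "Q = (\<Sum>i\<in>{k+1..n}. p i)"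
  have PQ: "P \<ge> 0" "Q \<ge> 0" by (simp_all add: P_def Q_def p sum_nonneg)
  have "{m..n} = {m..k} \<union> {k+1..n}" using k by auto
  then have sumPQ: "(\<Sum>i\<in>{m..n}. p i) = P + Q"
    unfolding P_def Q_def by (simp add: sum.union_disjoint)
  have "(\<Sum>i\<in>{m..k}. \<Sum>j\<in>{k+1..n}. p i * p j * (b j - b i))
      = (\<Sum>i\<in>{m..k}. \<Sum>j\<in>{k+1..n}. p i * (b j * p j) - (b i * p i) * p j)"
    by (intro sum.cong refl) (simp add: algebra_simps)
  also have "\<dots> = P * (a k - a n) - (a (m - 1) - a k) * Q"
    using tel[of m k] tel[of "k+1" n] k
    by (simp add: P_def Q_def sum_subtractf sum_product[symmetric])
  also have "\<dots> \<le> a k * (P + Q)"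
    using mult_nonneg_nonneg[OF PQ(1) a[of n]] mult_nonneg_nonneg[OF PQ(2) a[of "m-1"]]
    by (simp add: algebra_simps)
  finally show ?thesis using sumPQ by simp
qed

lemma discrete_poincare_finite:
  fixes p a b f :: "int \<Rightarrow> real"
  assumes a: "\<And>i. a i \<ge> 0" and p: "\<And>i. p i \<ge> 0"
    and bp: "\<And>i. b i * p i = a (i - 1) - a i"
    and inc: "\<And>i. b (i + 1) - b i \<ge> c" and c: "c > 0"
  shows "(\<Sum>i\<in>{m..n}. p i) * (\<Sum>i\<in>{m..n}. p i * (f i)\<^sup>2) - (\<Sum>i\<in>{m..n}. p i * f i)\<^sup>2
     \<le> 1 / c * ((\<Sum>i\<in>{m..n}. p i) * (\<Sum>k\<in>{m..<n}. a k * (f (k + 1) - f k)\<^sup>2))"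
proof -
  define D where "D k = (f (k + 1) - f k)\<^sup>2" for k
  define g where "g i j = p i * p j * (f j - f i)\<^sup>2" for i j
  define w where "w i j = p i * p j * (b j - b i)" for i j
  \<comment> \<open>Each pair is charged to the edges between its points. The indicator makes every
    sum range over the whole window, so that the order of summation can be changed.\<close>
  have pair: "(if i < j then g i j else 0)
      \<le> (\<Sum>k\<in>{m..<n}. if i \<le> k \<and> k < j then 1 / c * (w i j * D k) else 0)"
    if "i \<in> {m..n}" "j \<in> {m..n}" for i j
  proof (cases "i < j")
    case True
    have S: "(\<Sum>k\<in>{i..<j}. D k) \<ge> 0" by (simp add: D_def sum_nonneg)
    have "(f j - f i)\<^sup>2 \<le> of_int (j - i) * (\<Sum>k\<in>{i..<j}. D k)"
      unfolding D_def by (rule square_diff_le_sum_squares[OF True])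
    \<comment> \<open>The length \<open>j - i\<close> is traded for an increment of
      \<open>b\<close>, because the latter telescopes against \<open>p\<close>.\<close>
    also have "\<dots> \<le> (1 / c * (b j - b i)) * (\<Sum>k\<in>{i..<j}. D k)"
      using increment_int_ge[of c b i j, OF inc] True c
      by (intro mult_right_mono[OF _ S]) (simp add: field_simps)
    finally have "g i j \<le> p i * p j * ((1 / c * (b j - b i)) * (\<Sum>k\<in>{i..<j}. D k))"
      unfolding g_def by (intro mult_left_mono) (simp_all add: p)
    also have "\<dots> = (\<Sum>k\<in>{i..<j}. 1 / c * (w i j * D k))"
      by (simp add: w_def sum_distrib_left sum_divide_distrib mult_ac)
    also have "{i..<j} = {m..<n} \<inter> {k. i \<le> k \<and> k < j}" using that by auto
    also have "(\<Sum>k\<in>\<dots>. 1 / c * (w i j * D k))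
        = (\<Sum>k\<in>{m..<n}. if i \<le> k \<and> k < j then 1 / c * (w i j * D k) else 0)"
      by (subst sum.inter_restrict) auto
    finally show ?thesis using True by simp
  next
    case False
    then have "(\<Sum>k\<in>{m..<n}. if i \<le> k \<and> k < j then 1 / c * (w i j * D k) else 0) = 0"
      by (intro sum.neutral) auto
    then show ?thesis using False by simp
  qed
  have "(\<Sum>i\<in>{m..n}. \<Sum>j\<in>{m..n}. if i < j then g i j else 0)
      \<le> (\<Sum>i\<in>{m..n}. \<Sum>j\<in>{m..n}. \<Sum>k\<in>{m..<n}. if i \<le> k \<and> k < j then 1 / c * (w i j * D k) else 0)"
    by (intro sum_mono pair)
  \<comment> \<open>Two exchanges bring the edge \<open>k\<close> outermost; what remains inside is
    the total weight of the pairs across it.\<close>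
  also have "\<dots> = (\<Sum>i\<in>{m..n}. \<Sum>k\<in>{m..<n}. \<Sum>j\<in>{m..n}. if i \<le> k \<and> k < j then 1 / c * (w i j * D k) else 0)"
    by (intro sum.cong refl sum.swap)
  also have "\<dots> = (\<Sum>k\<in>{m..<n}. \<Sum>i\<in>{m..n}. \<Sum>j\<in>{m..n}. if i \<le> k \<and> k < j then 1 / c * (w i j * D k) else 0)"
    by (rule sum.swap)
  also have "\<dots> = (\<Sum>k\<in>{m..<n}. \<Sum>i\<in>{m..k}. \<Sum>j\<in>{k+1..n}. 1 / c * (w i j * D k))"
  proof (rule sum.cong[OF refl])
    fix k assume k: "k \<in> {m..<n}"
    have "{m..k} = {m..n} \<inter> {i. i \<le> k}" "{k+1..n} = {m..n} \<inter> {j. k < j}" using k by auto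
    then show "(\<Sum>i\<in>{m..n}. \<Sum>j\<in>{m..n}. if i \<le> k \<and> k < j then 1 / c * (w i j * D k) else 0)
        = (\<Sum>i\<in>{m..k}. \<Sum>j\<in>{k+1..n}. 1 / c * (w i j * D k))"
      by (auto simp: sum.inter_restrict intro!: sum.cong)
  qed
  also have "\<dots> = (\<Sum>k\<in>{m..<n}. 1 / c * (D k * (\<Sum>i\<in>{m..k}. \<Sum>j\<in>{k+1..n}. w i j)))"
    by (simp add: sum_distrib_left mult_ac)
  also have "\<dots> \<le> (\<Sum>k\<in>{m..<n}. 1 / c * (D k * (a k * (\<Sum>i\<in>{m..n}. p i))))"
    using edge_weight_le[of a p b, OF a p bp] c
    by (intro sum_mono mult_left_mono) (auto simp: w_def D_def)
  also have "\<dots> = 1 / c * ((\<Sum>i\<in>{m..n}. p i) * (\<Sum>k\<in>{m..<n}. a k * D k))"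
    by (simp add: sum_distrib_left mult_ac)
  finally have "(\<Sum>i\<in>{m..n}. \<Sum>j\<in>{m..n}. if i < j then g i j else 0)
      \<le> 1 / c * ((\<Sum>i\<in>{m..n}. p i) * (\<Sum>k\<in>{m..<n}. a k * D k))" .
  moreover have "(\<Sum>i\<in>{m..n}. \<Sum>j\<in>{m..n}. g i j)
      = 2 * (\<Sum>i\<in>{m..n}. \<Sum>j\<in>{m..n}. if i < j then g i j else 0)"
    by (rule sum_symmetric_pairs) (simp_all add: g_def power2_commute mult.commute)
  moreover have "(\<Sum>i\<in>{m..n}. \<Sum>j\<in>{m..n}. g i j)
      = 2 * ((\<Sum>i\<in>{m..n}. p i) * (\<Sum>i\<in>{m..n}. p i * (f i)\<^sup>2) - (\<Sum>i\<in>{m..n}. p i * f i)\<^sup>2)"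
    unfolding g_def by (rule sum_pairs_square_diff)
  ultimately show ?thesis by (simp add: D_def)
qed

section \<open>From finite windows to all integers\<close>

lemma has_sum_tendsto_symmetric_intervals:
  fixes f :: "int \<Rightarrow> 'a::{comm_monoid_add,topological_space}"
  assumes "(f has_sum s) UNIV"
  shows "(\<lambda>N. \<Sum>i\<in>{- int N..int N}. f i) \<longlonglongrightarrow> s"
proof -
  have "filterlim (\<lambda>N. {- int N..int N}) (finite_subsets_at_top UNIV) sequentially"
    unfolding filterlim_finite_subsets_at_top
  proof (intro allI impI)
    fix X :: "int set" assume X: "finite X \<and> X \<subseteq> UNIV"
    \<comment> \<open>Inserting 0 keeps \<open>Max\<close> meaningful when \<open>X\<close> is
      empty.\<close>
    define M where "M = nat (Max (insert 0 (abs ` X)))"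
    have M: "\<bar>x\<bar> \<le> int M" if "x \<in> X" for x
      unfolding M_def using X that by (auto intro!: Max_ge)
    show "\<forall>\<^sub>F N in sequentially. finite {- int N..int N} \<and> X \<subseteq> {- int N..int N}
        \<and> {- int N..int N} \<subseteq> UNIV"
      using eventually_ge_at_top[of M] by eventually_elim (use M in fastforce)
  qed
  then show ?thesis using assms unfolding has_sum_def by (rule filterlim_compose[rotated])
qed

text \<open>The finite inequality is passed to the limit along symmetric windows. Only the mass and
  the moments need limits: the window's energy has nonnegative terms and is bounded by the full
  energy beforehand.\<close>

lemma discrete_poincare:
  fixes p a b f :: "int \<Rightarrow> real"
  assumes a: "\<And>i. a i \<ge> 0" and p: "\<And>i. p i \<ge> 0"
    and bp: "\<And>i. b i * p i = a (i - 1) - a i"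
    and inc: "\<And>i. b (i + 1) - b i \<ge> c" and c: "c > 0"
    and p1: "(p has_sum 1) UNIV"
    and f2: "(\<lambda>i. p i * (f i)\<^sup>2) summable_on UNIV"
    and E: "(\<lambda>i. a i * (f (i + 1) - f i)\<^sup>2) summable_on UNIV"
  shows "(\<Sum>\<^sub>\<infinity>i. p i * (f i)\<^sup>2) - (\<Sum>\<^sub>\<infinity>i. p i * f i)\<^sup>2
           \<le> 1 / c * (\<Sum>\<^sub>\<infinity>i. a i * (f (i + 1) - f i)\<^sup>2)"
proof -
  \<comment> \<open>Without summability the mean would be the default value 0 of
    \<open>infsum\<close> rather than a limit of partial sums. The majorant is
    \<open>p i * (1 + (f i)^2)\<close>.\<close>
  have "(\<lambda>i. p i * f i) summable_on UNIV"
  proof (rule abs_summable_summable, rule summable_on_comparison_test)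
    show "(\<lambda>i. p i + p i * (f i)\<^sup>2) summable_on UNIV"
      using p1 f2 by (intro summable_on_add) (auto intro: has_sum_imp_summable)
    have "\<bar>x\<bar> \<le> 1 + x\<^sup>2" for x :: real
      using sum_power2_ge_zero[of "\<bar>x\<bar> - 1" 0] by (simp add: power2_eq_square algebra_simps)
    then show "norm (p i * f i) \<le> p i + p i * (f i)\<^sup>2" for i
      using mult_left_mono[of "\<bar>f i\<bar>" "1 + (f i)\<^sup>2" "p i"] p[of i]
      by (simp add: abs_mult distrib_left)
  qed simp
  note S = has_sum_tendsto_symmetric_intervals[OF p1]
    has_sum_tendsto_symmetric_intervals[OF has_sum_infsum[OF this]]
    has_sum_tendsto_symmetric_intervals[OF has_sum_infsum[OF f2]]
  let ?A = "\<lambda>N::nat. {- int N..int N}"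
  let ?E = "\<Sum>\<^sub>\<infinity>i. a i * (f (i + 1) - f i)\<^sup>2"
  have "(\<lambda>N. (\<Sum>i\<in>?A N. p i) * (\<Sum>i\<in>?A N. p i * (f i)\<^sup>2) - (\<Sum>i\<in>?A N. p i * f i)\<^sup>2)
      \<longlonglongrightarrow> 1 * (\<Sum>\<^sub>\<infinity>i. p i * (f i)\<^sup>2) - (\<Sum>\<^sub>\<infinity>i. p i * f i)\<^sup>2"
    by (intro tendsto_intros S)
  moreover have "(\<lambda>N. 1 / c * ((\<Sum>i\<in>?A N. p i) * ?E)) \<longlonglongrightarrow> 1 / c * (1 * ?E)"
    by (intro tendsto_intros S)
  moreover have "(\<Sum>i\<in>?A N. p i) * (\<Sum>i\<in>?A N. p i * (f i)\<^sup>2) - (\<Sum>i\<in>?A N. p i * f i)\<^sup>2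
      \<le> 1 / c * ((\<Sum>i\<in>?A N. p i) * ?E)" for N
  proof -
    have "(\<Sum>k\<in>{- int N..<int N}. a k * (f (k + 1) - f k)\<^sup>2) \<le> ?E"
      using E a by (intro finite_sum_le_infsum) auto
    then have "1 / c * ((\<Sum>i\<in>?A N. p i) * (\<Sum>k\<in>{- int N..<int N}. a k * (f (k + 1) - f k)\<^sup>2))
        \<le> 1 / c * ((\<Sum>i\<in>?A N. p i) * ?E)"
      using c p by (intro mult_left_mono) (auto intro: sum_nonneg)
    then show ?thesis
      using discrete_poincare_finite[of a p b c "- int N" "int N" f, OF a p bp inc c] by linarith
  qed
  ultimately show ?thesis
    using LIMSEQ_le by (metis (no_types, lifting) mult_1)
qed

section \<open>Admissible functions and their behaviour at 0\<close>

lemma admissible_reflect: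
  assumes "admissible B"
  shows "B (- s) = exp s * B s"
proof -
  have "B s > 0" "B (- s) > 0" "ln (B (- s)) = s + ln (B s)"
    using assms by (auto simp: admissible_def algebra_simps)
  then show ?thesis by (metis exp_add exp_ln)
qed

text \<open>Differentiating \<open>B (- s) = exp s * B s\<close> at 0 gives
  \<open>- d = B 0 + d\<close> with \<open>B 0 = 1\<close>, which determines the slope.\<close>

lemma admissible_has_derivative_0:
  assumes "admissible B"
  shows "(B has_real_derivative - 1 / 2) (at 0)"
proof -
  obtain d where d: "(B has_real_derivative d) (at 0)"
    using assms unfolding admissible_def C1_differentiable_on_def
    by (auto simp: has_real_derivative_iff_has_vector_derivative)
  have "((\<lambda>s. B (- s)) has_real_derivative d * - 1) (at 0)"
    by (rule DERIV_chain2[where f = B]) (use d in \<open>auto intro!: derivative_eq_intros\<close>)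
  moreover have "((\<lambda>s. exp s * B s) has_real_derivative B 0 + d) (at 0)"
    by (rule derivative_eq_intros d | simp)+
  ultimately have "d * - 1 = B 0 + d"
    unfolding admissible_reflect[OF assms] by (rule DERIV_unique)
  moreover have "B 0 = 1" using assms by (simp add: admissible_def)
  ultimately have "d = - 1 / 2" by simp
  with d show ?thesis by simp
qed

text \<open>Monotonicity alone gives only \<le>. The negative slope at 0 makes the inequality strict
  just to the right of 0, and monotonicity carries it on to \<open>t\<close>.\<close>

lemma admissible_less_1:
  assumes "admissible B" and "t > 0"
  shows "B t < 1"
proof -
  have B: "antimono B" "B 0 = 1" using assms by (auto simp: admissible_def)
  from DERIV_neg_dec_right[OF admissible_has_derivative_0[OF assms(1)]]
  obtain e where e: "e > 0" "\<And>h. 0 < h \<Longrightarrow> h < e \<Longrightarrow> B h < 1" using B by auto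
  then have "B (min t (e / 2)) < 1" using assms by auto
  moreover have "B t \<le> B (min t (e / 2))" using B by (auto intro: antimonoD)
  ultimately show ?thesis by simp
qed

lemma admissible_convex_ge:
  assumes "admissible B" and "convex_on UNIV B"
  shows "B s \<ge> 1 - s / 2"
  using convex_on_imp_above_tangent[OF assms(2), of 0 s "-1/2"]
    admissible_has_derivative_0[OF assms(1)] assms(1)
  by (auto simp: admissible_def)

section \<open>Convexity and the slopes of the grid potential\<close>

text \<open>The points \<open>x + d\<close> and \<open>y\<close> are convex combinations of
  \<open>x\<close> and \<open>y + d\<close> with interchanged weights, so adding the two convexity
  inequalities gives the claim.\<close>

lemma convex_on_increment_mono:
  fixes B :: "real \<Rightarrow> real"
  assumes "convex_on UNIV B" and "x \<le> y" and "d \<ge> 0"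
  shows "B (x + d) - B x \<le> B (y + d) - B y"
proof (cases "x = y \<or> d = 0")
  case False
  define t where "t = d / (y - x + d)"
  have pos: "y - x + d > 0" using False assms by auto
  have t: "0 \<le> t" "t \<le> 1" using assms pos by (auto simp: t_def)
  have td: "t * (y - x + d) = d" using pos by (simp add: t_def)
  have 1: "x + d = (1 - t) * x + t * (y + d)" and 2: "y = t * x + (1 - t) * (y + d)"
    using td by (simp_all add: algebra_simps)
  have "B (x + d) \<le> (1 - t) * B x + t * B (y + d)"
    using convex_onD[OF assms(1) t, of x "y + d"] 1 by simp
  moreover have "B y \<le> t * B x + (1 - t) * B (y + d)"
    using convex_onD[OF assms(1), of "1 - t" x "y + d"] t 2 by simp
  ultimately show ?thesis by (simp add: algebra_simps)
qed auto

text \<open>Turns the bound on the second derivative into a form that applies to finite differences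
  with exact constants.\<close>

lemma convex_minus_quadratic:
  assumes "smooth u" and "\<And>x. deriv (deriv u) x \<ge> lam"
  shows "convex_on UNIV (\<lambda>x. u x - lam * x\<^sup>2 / 2)"
proof (rule f''_ge0_imp_convex)
  have d0: "(u has_real_derivative deriv u x) (at x)" for x
    using assms(1) unfolding smooth_def by (metis DERIV_deriv_iff_field_differentiable funpow_0)
  have d1: "(deriv u has_real_derivative deriv (deriv u) x) (at x)" for x
    using assms(1) unfolding smooth_def
    by (metis DERIV_deriv_iff_field_differentiable funpow_0 funpow.simps(2) comp_apply)
  show "((\<lambda>x. u x - lam * x\<^sup>2 / 2) has_real_derivative deriv u x - lam * x) (at x)" for x
    by (rule derivative_eq_intros d0 | simp)+
  show "((\<lambda>x. deriv u x - lam * x) has_real_derivative deriv (deriv u) x - lam) (at x)" for x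
    by (rule derivative_eq_intros d1 | simp)+
  show "0 \<le> deriv (deriv u) x - lam" for x using assms(2)[of x] by simp
qed simp

text \<open>Increments of \<open>u\<close> minus the parabola are monotone, and the parabola has
  second difference exactly \<open>lam * h^2\<close>.\<close>

lemma grid_slope_step:
  assumes "convex_on UNIV (\<lambda>x. u x - lam * x\<^sup>2 / 2)" and "h > 0"
  shows "grid u h (i + 2) - grid u h (i + 1) \<ge> grid u h (i + 1) - grid u h i + lam * h\<^sup>2"
proof -
  define x where "x = of_int i * h"
  have "grid u h i = u x" "grid u h (i + 1) = u (x + h)" "grid u h (i + 2) = u (x + h + h)"
    by (simp_all add: grid_def x_def algebra_simps)
  moreover have "lam * (x + h + h)\<^sup>2 / 2 - lam * (x + h)\<^sup>2 / 2 - (lam * (x + h)\<^sup>2 / 2 - lam * x\<^sup>2 / 2)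
      = lam * h\<^sup>2"
    by (simp add: power2_eq_square field_simps)
  ultimately show ?thesis
    using convex_on_increment_mono[OF assms(1), of x "x + h" h] assms(2) by simp
qed

section \<open>Lower bound on the increments of \<open>beta - alpha\<close>, uniform in
  \<open>h\<close>\<close>

text \<open>With slopes \<open>S\<close>, the increment times \<open>h^2\<close> is the drop of
  \<open>B\<close> from \<open>- S i\<close> to \<open>- S (i - 1)\<close> plus the drop from
  \<open>S i\<close> to \<open>S (i + 1)\<close>. One of the two starting points is at most
  \<open>- t\<close>. By convexity the drop over length \<open>d\<close> from there is at least the
  one from \<open>- t\<close>; the other drop is nonnegative and is discarded.\<close>

lemma beta_minus_alpha_increment:
  assumes B: "antimono B" "convex_on UNIV B"
    and u: "\<And>i. grid u h (i + 2) - grid u h (i + 1) \<ge> grid u h (i + 1) - grid u h i + d"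
    and d: "d \<ge> 0" and t: "\<bar>grid u h (i + 1) - grid u h i\<bar> \<ge> t"
  shows "(beta B u h (i + 1) - alpha B u h (i + 1)) - (beta B u h i - alpha B u h i)
           \<ge> (B (- t) - B (d - t)) / h\<^sup>2"
proof -
  define S where "S j = grid u h (j + 1) - grid u h j" for j
  have S: "S (j + 1) \<ge> S j + d" for j using u[of j] by (simp add: S_def add.assoc)
  have dec: "B x \<ge> B (x + d)" for x using B(1) d by (auto intro: antimonoD)
  have t': "S i \<ge> t \<or> - S i \<ge> t" using t by (auto simp: S_def)
  have "B (- t) - B (d - t) \<le> B (- S i) - B (- S i + d) + (B (S i) - B (S i + d))"
    using t'
  proof
    assume "S i \<ge> t"
    then show ?thesis
      using convex_on_increment_mono[OF B(2), of "- S i" "- t" d] d dec[of "S i"] by simp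
  next
    assume "- S i \<ge> t"
    then show ?thesis
      using convex_on_increment_mono[OF B(2), of "S i" "- t" d] d dec[of "- S i"] by simp
  qed
  \<comment> \<open>Both actual intervals have length at least \<open>d\<close>, and
    \<open>B\<close> is decreasing.\<close>
  also have "\<dots> \<le> B (- S i) - B (- S (i - 1)) + (B (S i) - B (S (i + 1)))"
    using antimonoD[OF B(1) S[of i]] antimonoD[OF B(1), of "- S i + d" "- S (i - 1)"] S[of "i - 1"]
    by simp
  finally have "(B (- t) - B (d - t)) / h\<^sup>2
      \<le> (B (- S i) - B (- S (i - 1)) + (B (S i) - B (S (i + 1)))) / h\<^sup>2"
    by (rule divide_right_mono) simp
  also have "\<dots> = (beta B u h (i + 1) - alpha B u h (i + 1)) - (beta B u h i - alpha B u h i)"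
    by (simp add: S_def alpha_def beta_def diff_divide_distrib add_divide_distrib)
  finally show ?thesis .
qed

text \<open>Slopes increase with \<open>i\<close>, so only those next to the origin,
  \<open>S 0\<close> and \<open>S (-1)\<close>, matter. The tangent at 0 of \<open>u\<close> minus
  the parabola gives each the size \<open>lam * h^2 / 2\<close> up to an error
  \<open>\<bar>u' * h\<bar>\<close>, which \<open>large\<close> bounds by half of that.\<close>

lemma grid_slope_large:
  assumes conv: "convex_on UNIV (\<lambda>x. u x - lam * x\<^sup>2 / 2)"
    and dif: "(u has_real_derivative u') (at 0)"
    and h: "h > 0" and lam: "lam > 0" and large: "lam * h \<ge> 4 * \<bar>u'\<bar>"
  shows "\<bar>grid u h (i + 1) - grid u h i\<bar> \<ge> lam * h\<^sup>2 / 4"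
proof -
  define S where "S j = grid u h (j + 1) - grid u h j" for j
  have S: "S j + lam * h\<^sup>2 \<le> S (j + 1)" for j
    using grid_slope_step[OF conv h, of j] by (simp add: S_def add.assoc)
  have mono: "S j \<le> S k" if "j \<le> k" for j k
    using that
  proof (induction k rule: int_ge_induct)
    case (step k)
    moreover have "0 \<le> lam * h\<^sup>2" using lam by simp
    ultimately show ?case using S[of k] by simp
  qed simp
  have "((\<lambda>x. u x - lam * x\<^sup>2 / 2) has_real_derivative u') (at 0)"
    by (rule derivative_eq_intros dif | simp)+
  then have tangent: "u x - lam * x\<^sup>2 / 2 - u 0 \<ge> u' * x" for x
    using convex_on_imp_above_tangent[OF conv, of 0 x u'] by simp
  have "\<bar>u'\<bar> * h \<le> lam * h\<^sup>2 / 4"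
    using mult_right_mono[OF large, of h] h by (simp add: power2_eq_square)
  then have bound: "\<bar>u' * h\<bar> \<le> lam * h\<^sup>2 / 4" using h by (simp add: abs_mult)
  show ?thesis
  proof (cases "i \<ge> 0")
    case True
    have "S 0 \<ge> lam * h\<^sup>2 / 4" using tangent[of h] bound by (simp add: S_def grid_def)
    with mono[OF True] show ?thesis unfolding S_def by linarith
  next
    case False
    then have "S i \<le> S (-1)" by (intro mono) simp
    moreover have "S (-1) \<le> - (lam * h\<^sup>2 / 4)"
      using tangent[of "-h"] bound by (simp add: S_def grid_def)
    ultimately show ?thesis unfolding S_def by linarith
  qed
qed

lemma curvature_bound:
  fixes B u :: "real \<Rightarrow> real"
  assumes B: "admissible B" "convex_on UNIV B"
    and u: "smooth u" "\<And>x. deriv (deriv u) x \<ge> lam" and lam: "lam > 0"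
  shows "\<exists>c>0. \<forall>h>0. \<forall>i.
    (beta B u h (i + 1) - alpha B u h (i + 1)) - (beta B u h i - alpha B u h i) \<ge> c"
proof -
  note conv = convex_minus_quadratic[OF u]
  have anti: "antimono B" and B0: "B 0 = 1" using B by (auto simp: admissible_def)
  have d0: "(u has_real_derivative deriv u 0) (at 0)"
    using u(1) unfolding smooth_def by (metis DERIV_deriv_iff_field_differentiable funpow_0)
  \<comment> \<open>Beyond the first summand \<open>grid_slope_large\<close> applies; the added 1
    keeps \<open>H\<close> positive if the derivative vanishes.\<close>
  define H where "H = 4 * \<bar>deriv u 0\<bar> / lam + 1"
  have H: "H > 0" using lam by (simp add: H_def add_nonneg_pos)
  \<comment> \<open>The first entry serves \<open>h \<le> H\<close>, the second
    \<open>h > H\<close>.\<close>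
  define c where "c = min ((1 - B (lam * H\<^sup>2)) / H\<^sup>2) (lam / 8)"
  have "B (lam * H\<^sup>2) < 1" using lam H by (intro admissible_less_1[OF B(1)]) simp
  then have "c > 0" using lam H by (simp add: c_def)
  moreover have "(beta B u h (i + 1) - alpha B u h (i + 1)) - (beta B u h i - alpha B u h i) \<ge> c"
    if h: "h > 0" for h i
  proof (cases "h \<le> H")
    case True
    \<comment> \<open>\<open>t\<close> is the weight that writes \<open>lam * h^2\<close> as a
      convex combination of 0 and \<open>lam * H^2\<close>. Convexity then shows that the bound
      \<open>(1 - B (lam * h^2)) / h^2\<close> is no smaller than its value at
      \<open>H\<close>.\<close>
    define t where "t = h\<^sup>2 / H\<^sup>2"
    have t: "0 \<le> t" "t \<le> 1" using h H True by (auto simp: t_def power_mono)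
    have "t * (lam * H\<^sup>2) = lam * h\<^sup>2" using H by (simp add: t_def)
    then have "B (lam * h\<^sup>2) \<le> (1 - t) + t * B (lam * H\<^sup>2)"
      using convex_onD[OF B(2) t, of 0 "lam * H\<^sup>2"] by (simp only: real_scaleR_def B0) simp
    then have "t * (1 - B (lam * H\<^sup>2)) \<le> 1 - B (lam * h\<^sup>2)" by (simp add: algebra_simps)
    then have "t * (1 - B (lam * H\<^sup>2)) / h\<^sup>2 \<le> (1 - B (lam * h\<^sup>2)) / h\<^sup>2"
      by (rule divide_right_mono) simp
    then have "c \<le> (1 - B (lam * h\<^sup>2)) / h\<^sup>2"
      using h by (simp add: c_def t_def min_le_iff_disj)
    also have "\<dots> = (B (- 0) - B (lam * h\<^sup>2 - 0)) / h\<^sup>2" by (simp add: B0)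
    also have "\<dots> \<le> (beta B u h (i + 1) - alpha B u h (i + 1)) - (beta B u h i - alpha B u h i)"
      using lam by (intro beta_minus_alpha_increment[OF anti B(2) grid_slope_step[OF conv h]]) auto
    finally show ?thesis .
  next
    case False
    let ?d = "lam * h\<^sup>2"
    have d: "?d > 0" using lam h by simp
    have "4 * \<bar>deriv u 0\<bar> / lam \<le> h" using False by (simp add: H_def)
    then have large: "4 * \<bar>deriv u 0\<bar> \<le> lam * h" using lam by (simp add: field_simps)
    have "B (- (?d / 4)) \<ge> 1 + ?d / 8" using admissible_convex_ge[OF B, of "- (?d / 4)"] by simp
    moreover have "B (?d - ?d / 4) \<le> 1" using antimonoD[OF anti, of 0 "?d - ?d / 4"] d B0 by simp
    ultimately have "?d / 8 \<le> B (- (?d / 4)) - B (?d - ?d / 4)" by simp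
    then have "?d / 8 / h\<^sup>2 \<le> (B (- (?d / 4)) - B (?d - ?d / 4)) / h\<^sup>2"
      by (rule divide_right_mono) simp
    moreover have "?d / 8 / h\<^sup>2 = lam / 8" using h by simp
    ultimately have "c \<le> (B (- (?d / 4)) - B (?d - ?d / 4)) / h\<^sup>2"
      unfolding c_def by linarith
    also have "\<dots> \<le> (beta B u h (i + 1) - alpha B u h (i + 1)) - (beta B u h i - alpha B u h i)"
      using d grid_slope_large[OF conv d0 h lam large]
      by (intro beta_minus_alpha_increment[OF anti B(2) grid_slope_step[OF conv h]]) auto
    finally show ?thesis .
  qed
  ultimately show ?thesis by blast
qed

section \<open>Detailed balance and the Dirichlet form\<close>

text \<open>The factor \<open>exp s\<close> from \<open>admissible_reflect\<close>, with
  \<open>s\<close> the slope at \<open>i\<close>, is the ratio of the two Gibbs weights. The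
  normaliser is common to both sides, so its value is irrelevant.\<close>

lemma detailed_balance:
  assumes "admissible B"
  shows "beta B u h (i + 1) * pi_h u h (i + 1) = alpha B u h i * pi_h u h i"
proof -
  have "B (grid u h i - grid u h (i + 1)) * exp (- grid u h (i + 1))
      = B (grid u h (i + 1) - grid u h i) * exp (- grid u h i)"
    using admissible_reflect[OF assms, of "grid u h (i + 1) - grid u h i"]
    by (simp add: exp_add[symmetric] mult.commute mult.left_commute)
  then show ?thesis by (simp add: alpha_def beta_def pi_h_def)
qed

text \<open>By detailed balance every edge occurs twice in the sum with weight 1/2, as forward
  difference at its left end and as backward difference at its right end. Shifting the index by one
  merges the halves.\<close>

lemma Gamma_h_infsum:
  assumes B: "admissible B"
    and G: "(\<lambda>i. Gamma_h B u h f f i * pi_h u h i) summable_on UNIV"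
  defines "q \<equiv> \<lambda>i. alpha B u h i * pi_h u h i * (f (i + 1) - f i)\<^sup>2"
  shows "q summable_on UNIV" and "seq_inner (Gamma_h B u h f f) (pi_h u h) = infsum q UNIV"
proof -
  have pos: "alpha B u h i \<ge> 0" "pi_h u h i \<ge> 0" for i
    using B by (auto simp: alpha_def pi_h_def admissible_def less_imp_le intro!: divide_nonneg_nonneg infsum_nonneg)
  have q0: "q i \<ge> 0" for i using pos by (simp add: q_def)
  have eq: "Gamma_h B u h f f i * pi_h u h i = 1 / 2 * q i + 1 / 2 * q (i - 1)" for i
  proof -
    have "Gamma_h B u h f f i * pi_h u h i
        = 1 / 2 * (alpha B u h i * pi_h u h i * (Delta_plus f i)\<^sup>2)
          + 1 / 2 * (beta B u h i * pi_h u h i * (Delta_minus f i)\<^sup>2)"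
      by (simp add: Gamma_h_def power2_eq_square field_simps)
    also have "beta B u h i * pi_h u h i = alpha B u h (i - 1) * pi_h u h (i - 1)"
      using detailed_balance[OF B, of u h "i - 1"] by simp
    finally show ?thesis by (simp add: q_def Delta_plus_def Delta_minus_def)
  qed
  show q: "q summable_on UNIV"
  proof (rule summable_on_comparison_test)
    show "(\<lambda>i. 2 * (Gamma_h B u h f f i * pi_h u h i)) summable_on UNIV"
      by (intro summable_on_cmult_right G)
    show "q i \<le> 2 * (Gamma_h B u h f f i * pi_h u h i)" for i
      using q0[of "i - 1"] by (simp add: eq)
  qed (simp add: q0)
  have bij: "bij (\<lambda>i::int. i - 1)" by (rule bij_betwI[of _ _ _ "\<lambda>i. i + 1"]) auto
  have "(q has_sum infsum q UNIV) UNIV" using q by (rule has_sum_infsum)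
  moreover from this have "((\<lambda>i. q (i - 1)) has_sum infsum q UNIV) UNIV"
    using has_sum_reindex_bij_betw[OF bij] by blast
  ultimately have "((\<lambda>i. 1 / 2 * q i + 1 / 2 * q (i - 1)) has_sum
      1 / 2 * infsum q UNIV + 1 / 2 * infsum q UNIV) UNIV"
    by (intro has_sum_add has_sum_cmult_right)
  then show "seq_inner (Gamma_h B u h f f) (pi_h u h) = infsum q UNIV"
    unfolding seq_inner_def eq by (simp add: infsumI)
qed

section \<open>Poincare inequality for the grid measure\<close>

theorem theorem1p2:
  fixes B u :: "real \<Rightarrow> real" and lam :: real
  assumes "admissible B"
    and "convex_on UNIV B"
    and "smooth u"
    and "lam > 0"
    and "\<And>x. deriv (deriv u) x \<ge> lam"
  shows "\<exists>kappa>0. \<forall>h>0. \<forall>f\<in>H1 B u h.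
           seq_inner (\<lambda>i. (f i)\<^sup>2) (pi_h u h) - (seq_inner f (pi_h u h))\<^sup>2
             \<le> 1 / kappa * seq_inner (Gamma_h B u h f f) (pi_h u h)"
proof -
  \<comment> \<open>This \<open>c\<close> is the witness for \<open>kappa\<close>; it is fixed
    before \<open>h\<close>, which gives independence of the step size.\<close>
  obtain c where c: "c > 0" and inc: "\<And>h i. h > 0 \<Longrightarrow>
      (beta B u h (i + 1) - alpha B u h (i + 1)) - (beta B u h i - alpha B u h i) \<ge> c"
    using curvature_bound[OF assms(1,2,3,5,4)] by blast
  have "seq_inner (\<lambda>i. (f i)\<^sup>2) (pi_h u h) - (seq_inner f (pi_h u h))\<^sup>2
      \<le> 1 / c * seq_inner (Gamma_h B u h f f) (pi_h u h)" if h: "h > 0" and f: "f \<in> H1 B u h" for h f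
  proof (cases "(\<lambda>j. exp (- grid u h j)) summable_on UNIV")
    case False
    \<comment> \<open>Then the normalising \<open>infsum\<close> is \<open>0\<close> and division by zero makes \<^const>\<open>pi_h\<close> vanish;
      strong convexity excludes this case, but the claim is trivial in it anyway.\<close>
    then have "pi_h u h i = 0" for i by (simp add: pi_h_def infsum_not_exists)
    then show ?thesis by (simp add: seq_inner_def)
  next
    case True
    define Z where "Z = (\<Sum>\<^sub>\<infinity>j. exp (- grid u h j))"
    have Zsum: "((\<lambda>j. exp (- grid u h j)) has_sum Z) UNIV"
      unfolding Z_def using True by (rule has_sum_infsum)
    \<comment> \<open>A single term bounds \<open>Z\<close> away from 0, so that \<open>pi_h\<close>
      really has mass 1.\<close>
    have "exp (- grid u h 0) \<le> Z"
      using finite_sum_le_infsum[OF True, of "{0}"] by (simp add: Z_def)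
    then have "Z > 0" by (smt (verit) exp_gt_zero)
    have "((\<lambda>j. exp (- grid u h j) * inverse Z) has_sum Z * inverse Z) UNIV"
      by (intro has_sum_cmult_left Zsum)
    moreover have "pi_h u h = (\<lambda>j. exp (- grid u h j) * inverse Z)"
      by (simp add: pi_h_def Z_def divide_inverse fun_eq_iff)
    ultimately have p1: "(pi_h u h has_sum 1) UNIV" using \<open>Z > 0\<close> by simp
    have p: "pi_h u h i \<ge> 0" for i using \<open>Z > 0\<close> by (simp add: pi_h_def Z_def)
    have a: "alpha B u h i * pi_h u h i \<ge> 0" for i
      using p assms(1) by (simp add: alpha_def admissible_def less_imp_le)
    \<comment> \<open>Detailed balance moves the \<open>beta\<close> term to the edge on the left of
      \<open>i\<close>, producing the telescoping form with edge weights
      \<open>alpha * pi_h\<close>.\<close>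
    have bp: "(beta B u h i - alpha B u h i) * pi_h u h i
        = alpha B u h (i - 1) * pi_h u h (i - 1) - alpha B u h i * pi_h u h i" for i
      using detailed_balance[OF assms(1), of u h "i - 1"] by (simp add: algebra_simps)
    have f2: "(\<lambda>i. pi_h u h i * (f i)\<^sup>2) summable_on UNIV"
      and G: "(\<lambda>i. Gamma_h B u h f f i * pi_h u h i) summable_on UNIV"
      using f by (simp_all add: H1_def mult.commute)
    show ?thesis
      using discrete_poincare[of "\<lambda>i. alpha B u h i * pi_h u h i" "pi_h u h"
          "\<lambda>i. beta B u h i - alpha B u h i" c f, OF a p bp inc[OF h] c p1 f2
          Gamma_h_infsum(1)[OF assms(1) G]]
      unfolding Gamma_h_infsum(2)[OF assms(1) G] by (simp add: seq_inner_def mult.commute)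
  qed
  then show ?thesis using c by blast
qed

end
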